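(* Let $(X,d,\preccurlyeq)$ be a $T_1$ sequentially increasingly right $K$-complete preordered quasi-metric space. Suppose that for every sequence $(x_n)_{n\in\mathbb{N}}$ in $X$ and every $x\in X$: if $x_n\preccurlyeq x_{n+1}$ for all $n\in\mathbb{N}$ and $x_n\xrightarrow{d}x$, then $x_n\preccurlyeq x$ for all $n\in\mathbb{N}$. Let $\varphi:X\to\mathbb{R}\cup\{\infty\}$ be a proper, bounded below and increasingly lsc function, and for $x\in X$ put $S(x)=\{y\in X: x\preccurlyeq y \text{ and } \varphi(y)+d(y,x)\le\varphi(x)\}$. The following are true. 1. There exists $z\in\operatorname{dom}\varphi$ such that $\varphi(z)<\varphi(x)+d(x,z)$ for all $x\in\operatorname{dom}\varphi\setminus\{z\}$ with $z\preccurlyeq x$. 2. If for every $x\in\operatorname{dom}\varphi$ $$\varphi(x)>\inf\varphi(X)\ \Rightarrow\ S(x)\setminus\{x\}\ne\emptyset,$$ then there exists $z\in\operatorname{dom}\varphi$ such that $\varphi(z)=\inf\varphi(X)$. 3. (a) If the mapping $T:X\to X$ satisfies $x\preccurlyeq Tx$ and $d(Tx,x)+\varphi(Tx)\le\varphi(x)$ for all $x\in\operatorname{dom}\varphi$, then there exists $z\in\operatorname{dom}\varphi$ such that $Tz=z$. (b) If $T:X\rightrightarrows X$ is a set-valued mapping such that $S(x)\cap Tx\ne\emptyset$ for every $x\in\operatorname{dom}\varphi$, then there exists $z\in\operatorname{dom}\varphi$ such that $z\in Tz$.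
   Context: A quasi-metric on a set $X$ is a map $d:X\times X\to[0,\infty)$ with $d(x,x)=0$, $d(x,z)\le d(x,y)+d(y,z)$, and $d(x,y)=d(y,x)=0\Rightarrow x=y$ (symmetry is not required). The topology $\tau_d$ is generated by the balls $B_d(x,r)=\{y: d(x,y)<r\}$; all topological notions refer to $\tau_d$. Thus $x_n\xrightarrow{d}x$ means $d(x,x_n)\to0$. The quasi-metric space is $T_1$ if $\tau_d$ is $T_1$, equivalently $d(x,y)>0$ for all $x\ne y$. A preordered quasi-metric space $(X,d,\preccurlyeq)$ is a quasi-metric space with a reflexive and transitive relation $\preccurlyeq$. A sequence is increasing if $x_n\preccurlyeq x_{n+1}$ for all $n$. A sequence is right $K$-Cauchy if for every $\varepsilon>0$ there is $n_\varepsilon$ such that $d(x_m,x_n)<\varepsilon$ whenever $n_\varepsilon\le n<m$. The space is sequentially increasingly right $K$-complete if every increasing right $K$-Cauchy sequence is convergent (with respect to $\tau_d$). For $\varphi:X\to\mathbb{R}\cup\{\infty\}$, $\operatorname{dom}\varphi=\{x:\varphi(x)<\infty\}$; $\varphi$ is proper if $\operatorname{dom}\varphi\ne\emptyset$; $\varphi$ is increasingly lsc if $\varphi(x)\le\liminf_n\varphi(x_n)$ for every increasing sequence $(x_n)$ with $x_n\xrightarrow{d}x$. A set-valued mapping $T:X\rightrightarrows X$ assigns to each $x\in X$ a subset $Tx\subseteq X$. *)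

theory Defs
  imports "HOL-Analysis.Analysis"
begin

text \<open>
  Spaces are given by an explicit carrier \<open>X\<close>; the values of \<open>d\<close>, of the preorder and of
  \<open>\<phi>\<close> outside \<open>X\<close> play no role.
\<close>

locale quasi_metric_space =
  fixes X :: "'a set" and d :: "'a \<Rightarrow> 'a \<Rightarrow> real"
  assumes nonneg: "x \<in> X \<Longrightarrow> y \<in> X \<Longrightarrow> 0 \<le> d x y"
    and refl_zero: "x \<in> X \<Longrightarrow> d x x = 0"
    and triangle: "x \<in> X \<Longrightarrow> y \<in> X \<Longrightarrow> z \<in> X \<Longrightarrow> d x z \<le> d x y + d y z"
    and zero_imp_eq: "x \<in> X \<Longrightarrow> y \<in> X \<Longrightarrow> d x y = 0 \<Longrightarrow> d y x = 0 \<Longrightarrow> x = y"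

locale preordered_quasi_metric_space = quasi_metric_space X d
  for X :: "'a set" and d :: "'a \<Rightarrow> 'a \<Rightarrow> real" +
  fixes le :: "'a \<Rightarrow> 'a \<Rightarrow> bool"
  assumes le_refl: "reflp_on X le"
    and le_trans: "transp_on X le"

definition qm_ball :: "'a set \<Rightarrow> ('a \<Rightarrow> 'a \<Rightarrow> real) \<Rightarrow> 'a \<Rightarrow> real \<Rightarrow> 'a set" where
  "qm_ball X d x r = {y \<in> X. d x y < r}"

definition qm_topology :: "'a set \<Rightarrow> ('a \<Rightarrow> 'a \<Rightarrow> real) \<Rightarrow> 'a topology" where
  "qm_topology X d = topology_generated_by {qm_ball X d x r | x r. x \<in> X \<and> 0 < r}"

definition increasing_seq :: "'a set \<Rightarrow> ('a \<Rightarrow> 'a \<Rightarrow> bool) \<Rightarrow> (nat \<Rightarrow> 'a) \<Rightarrow> bool" where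
  "increasing_seq X le s \<longleftrightarrow> (\<forall>n. s n \<in> X) \<and> (\<forall>n. le (s n) (s (Suc n)))"

text \<open>In \<open>right_K_Cauchy\<close> the later term is the first argument of \<open>d\<close>.\<close>

definition right_K_Cauchy :: "('a \<Rightarrow> 'a \<Rightarrow> real) \<Rightarrow> (nat \<Rightarrow> 'a) \<Rightarrow> bool" where
  "right_K_Cauchy d s \<longleftrightarrow> (\<forall>\<epsilon>>0. \<exists>N. \<forall>n m. N \<le> n \<and> n < m \<longrightarrow> d (s m) (s n) < \<epsilon>)"

definition incr_right_K_complete ::
    "'a set \<Rightarrow> ('a \<Rightarrow> 'a \<Rightarrow> real) \<Rightarrow> ('a \<Rightarrow> 'a \<Rightarrow> bool) \<Rightarrow> bool" where
  "incr_right_K_complete X d le \<longleftrightarrow>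
     (\<forall>s. increasing_seq X le s \<and> right_K_Cauchy d s \<longrightarrow>
        (\<exists>x. limitin (qm_topology X d) s x sequentially))"

definition eff_dom :: "'a set \<Rightarrow> ('a \<Rightarrow> ereal) \<Rightarrow> 'a set" where
  "eff_dom X \<phi> = {x \<in> X. \<phi> x < \<infinity>}"

definition proper_fun :: "'a set \<Rightarrow> ('a \<Rightarrow> ereal) \<Rightarrow> bool" where
  "proper_fun X \<phi> \<longleftrightarrow> eff_dom X \<phi> \<noteq> {}"

definition bounded_below_fun :: "'a set \<Rightarrow> ('a \<Rightarrow> ereal) \<Rightarrow> bool" where
  "bounded_below_fun X \<phi> \<longleftrightarrow> (\<exists>c::real. \<forall>x\<in>X. ereal c \<le> \<phi> x)"

definition increasingly_lsc ::
    "'a set \<Rightarrow> ('a \<Rightarrow> 'a \<Rightarrow> real) \<Rightarrow> ('a \<Rightarrow> 'a \<Rightarrow> bool) \<Rightarrow> ('a \<Rightarrow> ereal) \<Rightarrow> bool" where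
  "increasingly_lsc X d le \<phi> \<longleftrightarrow>
     (\<forall>s x. increasing_seq X le s \<and> limitin (qm_topology X d) s x sequentially \<longrightarrow>
        \<phi> x \<le> liminf (\<lambda>n. \<phi> (s n)))"

definition S_set ::
    "'a set \<Rightarrow> ('a \<Rightarrow> 'a \<Rightarrow> real) \<Rightarrow> ('a \<Rightarrow> 'a \<Rightarrow> bool) \<Rightarrow> ('a \<Rightarrow> ereal) \<Rightarrow> 'a \<Rightarrow> 'a set" where
  "S_set X d le \<phi> x = {y \<in> X. le x y \<and> \<phi> y + ereal (d y x) \<le> \<phi> x}"

end

theory Submission
  imports Defs
begin

text \<open>
  From any \<open>x\<^sub>0\<close> in the domain choose \<open>x\<^sub>n\<^sub>+\<^sub>1 \<in> S(x\<^sub>n)\<close> almost minimizing \<open>\<phi>\<close> over \<open>S(x\<^sub>n)\<close>. Since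
  \<open>d(x\<^sub>m, x\<^sub>n) \<le> \<phi>(x\<^sub>n) - \<phi>(x\<^sub>m)\<close> for \<open>n < m\<close>, the sequence is right K-Cauchy, and its limit \<open>z\<close> lies in
  every \<open>S(x\<^sub>n)\<close>. By transitivity \<open>S(z) \<subseteq> S(x\<^sub>n)\<close>, so \<open>\<phi> \<ge> lim \<phi>(x\<^sub>n) \<ge> \<phi>(z)\<close> on \<open>S(z)\<close>; this forces
  \<open>d(y, z) = 0\<close> for \<open>y \<in> S(z)\<close>, and the \<open>T\<^sub>1\<close> property gives \<open>S(z) = {z}\<close>. Such a \<open>z\<close> serves in
  all parts of the theorem.
\<close>

context quasi_metric_space
begin

lemma openin_qm_ball:
  assumes "x \<in> X" "0 < r"
  shows "openin (qm_topology X d) (qm_ball X d x r)"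
  unfolding qm_topology_def using assms by (intro topology_generated_by_Basis) auto

lemma topspace_qm_topology: "topspace (qm_topology X d) = X"
proof
  show "topspace (qm_topology X d) \<subseteq> X"
    by (auto simp: qm_topology_def topology_generated_by_topspace qm_ball_def)
  show "X \<subseteq> topspace (qm_topology X d)"
  proof
    fix x assume x: "x \<in> X"
    then have "x \<in> qm_ball X d x 1" by (simp add: qm_ball_def refl_zero)
    then show "x \<in> topspace (qm_topology X d)"
      using openin_subset[OF openin_qm_ball[OF x, of 1]] by auto
  qed
qed

lemma openin_qm_topology_contains_ball:
  assumes "openin (qm_topology X d) U" "x \<in> U"
  shows "\<exists>r>0. qm_ball X d x r \<subseteq> U"
proof -
  have "generate_topology_on {qm_ball X d x r |x r. x \<in> X \<and> 0 < r} U"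
    using assms(1) by (simp add: qm_topology_def openin_topology_generated_by)
  then show ?thesis using assms(2)
  proof (induction arbitrary: x)
    case (Int a b)
    then obtain r s where "r > 0" "s > 0" "qm_ball X d x r \<subseteq> a" "qm_ball X d x s \<subseteq> b"
      by blast
    then show ?case by (intro exI[of _ "min r s"]) (auto simp: qm_ball_def)
  next
    case (UN K)
    then obtain k where k: "k \<in> K" "x \<in> k" by blast
    with UN.IH obtain r where "r > 0" "qm_ball X d x r \<subseteq> k" by blast
    with k show ?case by blast
  next
    case (Basis b)
    then obtain y r where y: "y \<in> X" "b = qm_ball X d y r" by blast
    with Basis.prems have x: "x \<in> X" "d y x < r" by (auto simp: qm_ball_def)
    have "qm_ball X d x (r - d y x) \<subseteq> b"
      using triangle[OF y(1) x(1)] y(2) by (fastforce simp: qm_ball_def)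
    with x show ?case by (intro exI[of _ "r - d y x"]) auto
  qed simp
qed

lemma t1_space_zero_imp_eq:
  assumes "t1_space (qm_topology X d)" "x \<in> X" "y \<in> X" "d x y = 0"
  shows "x = y"
proof (rule ccontr)
  assume "x \<noteq> y"
  then obtain U where U: "openin (qm_topology X d) U" "x \<in> U" "y \<notin> U"
    using assms(1-3) unfolding t1_space_def topspace_qm_topology by blast
  then obtain r where "r > 0" "qm_ball X d x r \<subseteq> U"
    using openin_qm_topology_contains_ball by blast
  with assms(3,4) U(3) show False by (auto simp: qm_ball_def)
qed

lemma limitin_qm_topology_imp_tendsto:
  assumes lim: "limitin (qm_topology X d) s x sequentially" and s: "\<And>n. s n \<in> X"
  shows "(\<lambda>n. d x (s n)) \<longlonglongrightarrow> 0"
proof -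
  have x: "x \<in> X" using limitin_topspace[OF lim] by (simp add: topspace_qm_topology)
  show ?thesis
  proof (rule tendstoI)
    fix e :: real assume e: "0 < e"
    have "x \<in> qm_ball X d x e" using x e by (simp add: qm_ball_def refl_zero)
    then have "\<forall>\<^sub>F n in sequentially. s n \<in> qm_ball X d x e"
      using lim openin_qm_ball[OF x e] unfolding limitin_def by blast
    then show "\<forall>\<^sub>F n in sequentially. dist (d x (s n)) 0 < e"
      by eventually_elim (use nonneg[OF x s] in \<open>auto simp: qm_ball_def\<close>)
  qed
qed

end

lemma right_K_Cauchy_if_potential:
  fixes g :: "nat \<Rightarrow> real"
  assumes bound: "\<And>n m. n < m \<Longrightarrow> d (s m) (s n) \<le> g n - g m" and "convergent g"
  shows "right_K_Cauchy d s"
  unfolding right_K_Cauchy_def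
proof (intro allI impI)
  fix e :: real assume "0 < e"
  then obtain N where N: "\<And>m n. N \<le> m \<Longrightarrow> N \<le> n \<Longrightarrow> dist (g m) (g n) < e"
    using convergent_Cauchy[OF \<open>convergent g\<close>] unfolding Cauchy_def by blast
  have "d (s m) (s n) < e" if "N \<le> n" "n < m" for n m
    using bound[OF that(2)] N[of n m] that by (simp add: dist_real_def)
  then show "\<exists>N. \<forall>n m. N \<le> n \<and> n < m \<longrightarrow> d (s m) (s n) < e" by blast
qed

context preordered_quasi_metric_space
begin

lemma self_mem_S_set: "x \<in> X \<Longrightarrow> x \<in> S_set X d le \<phi> x"
  using reflp_onD[OF le_refl] by (simp add: S_set_def refl_zero)

lemma S_set_trans:
  assumes "x \<in> X" "y \<in> S_set X d le \<phi> x" "w \<in> S_set X d le \<phi> y"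
  shows "w \<in> S_set X d le \<phi> x"
proof -
  have y: "y \<in> X" "le x y" "\<phi> y + ereal (d y x) \<le> \<phi> x"
    and w: "w \<in> X" "le y w" "\<phi> w + ereal (d w y) \<le> \<phi> y"
    using assms(2,3) by (auto simp: S_set_def)
  have "le x w" using transp_onD[OF le_trans] assms(1) y w by blast
  have "\<phi> w + ereal (d w x) \<le> \<phi> w + (ereal (d w y) + ereal (d y x))"
    using triangle[OF w(1) y(1) assms(1)] by (intro add_left_mono) simp
  also have "\<dots> = (\<phi> w + ereal (d w y)) + ereal (d y x)" by (simp add: add.assoc)
  also have "\<dots> \<le> \<phi> y + ereal (d y x)" using w(3) by (intro add_right_mono)
  finally show ?thesis using y(3) w(1) \<open>le x w\<close> by (auto simp: S_set_def)
qed

lemma S_set_subset_eff_dom: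
  assumes "x \<in> eff_dom X \<phi>"
  shows "S_set X d le \<phi> x \<subseteq> eff_dom X \<phi>"
proof
  fix y assume "y \<in> S_set X d le \<phi> x"
  then have "y \<in> X" "\<phi> y + ereal (d y x) < \<infinity>"
    using assms by (auto simp: S_set_def eff_dom_def)
  then show "y \<in> eff_dom X \<phi>" by (cases "\<phi> y") (auto simp: eff_dom_def)
qed

lemma ex_S_set_singleton:
  assumes t1: "t1_space (qm_topology X d)"
    and complete: "incr_right_K_complete X d le"
    and closed: "\<And>s x n. increasing_seq X le s \<Longrightarrow>
                   limitin (qm_topology X d) s x sequentially \<Longrightarrow> le (s n) x"
    and bdd: "bounded_below_fun X \<phi>"
    and lsc: "increasingly_lsc X d le \<phi>"
    and x0: "x0 \<in> eff_dom X \<phi>"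
  shows "\<exists>z \<in> S_set X d le \<phi> x0. S_set X d le \<phi> z = {z}"
proof -
  let ?S = "S_set X d le \<phi>" and ?D = "eff_dom X \<phi>"
  obtain c where c: "\<And>x. x \<in> X \<Longrightarrow> ereal c \<le> \<phi> x"
    using bdd by (auto simp: bounded_below_fun_def)
  define f where "f = (\<lambda>x. real_of_ereal (\<phi> x))"
  have DX: "x \<in> X" if "x \<in> ?D" for x using that by (simp add: eff_dom_def)
  have \<phi>f: "\<phi> x = ereal (f x)" if "x \<in> ?D" for x
    using that c[of x] by (cases "\<phi> x") (auto simp: f_def eff_dom_def)
  have cf: "c \<le> f x" if "x \<in> ?D" for x
    using c[OF DX[OF that]] \<phi>f[OF that] by simp
  have S_iff: "y \<in> ?S x \<longleftrightarrow> le x y \<and> f y + d y x \<le> f x"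
    if "x \<in> ?D" "y \<in> ?D" for x y
    using that \<phi>f DX by (simp add: S_set_def)
  have SD: "y \<in> ?D" if "x \<in> ?D" "y \<in> ?S x" for x y
    using S_set_subset_eff_dom that by blast

  have ex_next: "\<exists>y\<in>?S x. \<forall>w\<in>?S x. f y \<le> f w + e" if x: "x \<in> ?D" and e: "0 < e" for x e
  proof -
    have ne: "f ` ?S x \<noteq> {}" using self_mem_S_set[OF DX[OF x]] by blast
    have bb: "bdd_below (f ` ?S x)" using SD[OF x] cf by (intro bdd_belowI2[of _ c]) blast
    obtain y where "y \<in> ?S x" "f y < Inf (f ` ?S x) + e"
      using cInf_lessD[OF ne, of "Inf (f ` ?S x) + e"] e by auto
    moreover have "Inf (f ` ?S x) \<le> f w" if "w \<in> ?S x" for w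
      using cInf_lower[OF _ bb] that by blast
    ultimately show ?thesis by force
  qed
  have "\<exists>s. \<forall>n. (s n \<in> ?D \<and> (n = 0 \<longrightarrow> s n = x0)) \<and>
          (s (Suc n) \<in> ?S (s n) \<and> (\<forall>w\<in>?S (s n). f (s (Suc n)) \<le> f w + inverse (Suc n)))"
  proof (rule dependent_nat_choice)
    fix x and n :: nat assume "x \<in> ?D \<and> (n = 0 \<longrightarrow> x = x0)"
    then have x: "x \<in> ?D" by blast
    obtain y where "y \<in> ?S x" "\<forall>w\<in>?S x. f y \<le> f w + inverse (real (Suc n))"
      using ex_next[OF x, of "inverse (real (Suc n))"] by auto
    then show "\<exists>y. (y \<in> ?D \<and> (Suc n = 0 \<longrightarrow> y = x0)) \<and>
        (y \<in> ?S x \<and> (\<forall>w\<in>?S x. f y \<le> f w + inverse (Suc n)))"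
      using SD[OF x] by blast
  qed (use x0 in blast)
  then obtain s where s: "\<forall>n. (s n \<in> ?D \<and> (n = 0 \<longrightarrow> s n = x0)) \<and>
          (s (Suc n) \<in> ?S (s n) \<and> (\<forall>w\<in>?S (s n). f (s (Suc n)) \<le> f w + inverse (Suc n)))"
    by (rule exE)
  have sD: "s n \<in> ?D" and s0: "s 0 = x0" and s_Suc: "s (Suc n) \<in> ?S (s n)" for n
    using s by blast+
  have s_min: "f (s (Suc n)) \<le> f w + inverse (Suc n)" if "w \<in> ?S (s n)" for n w
    using s that by blast
  have sX: "s n \<in> X" for n using DX sD by blast
  have s_mem: "s m \<in> ?S (s n)" if "n \<le> m" for n m
    using that
  proof (induction rule: dec_induct)
    case base show ?case using self_mem_S_set sX by blast
  next
    case (step k) then show ?case using S_set_trans sX s_Suc by blast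
  qed
  have d_le: "d (s m) (s n) \<le> f (s n) - f (s m)" if "n \<le> m" for n m
    using s_mem[OF that] S_iff[OF sD sD] by (simp add: algebra_simps)
  have "f (s (Suc n)) \<le> f (s n)" for n
    using d_le[of n "Suc n"] nonneg[OF sX[of "Suc n"] sX[of n]] by linarith
  then have "decseq (\<lambda>n. f (s n))" by (rule decseq_SucI)
  then obtain L where L: "(\<lambda>n. f (s n)) \<longlonglongrightarrow> L"
    using decseq_convergent cf[OF sD] by blast
  have inc: "increasing_seq X le s"
    using sX s_Suc by (auto simp: increasing_seq_def S_set_def)
  moreover have "right_K_Cauchy d s"
    using d_le L by (intro right_K_Cauchy_if_potential[where g = "\<lambda>n. f (s n)"])
      (auto simp: convergent_def)
  ultimately obtain z where lim: "limitin (qm_topology X d) s z sequentially"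
    using complete unfolding incr_right_K_complete_def by blast
  have zX: "z \<in> X" using limitin_topspace[OF lim] by (simp add: topspace_qm_topology)
  have "(\<lambda>n. \<phi> (s n)) \<longlonglongrightarrow> ereal L" using L by (simp add: \<phi>f[OF sD])
  then have liminf: "liminf (\<lambda>n. \<phi> (s n)) = ereal L" by (intro lim_imp_Liminf) auto
  have "\<phi> z \<le> liminf (\<lambda>n. \<phi> (s n))"
    using lsc inc lim unfolding increasingly_lsc_def by blast
  then have \<phi>z: "\<phi> z \<le> ereal L" by (simp only: liminf)
  then have zD: "z \<in> ?D" using zX by (auto simp: eff_dom_def)
  have fz: "f z \<le> L" using \<phi>z \<phi>f[OF zD] by simp

  have zS: "z \<in> ?S (s n)" for n
  proof -
    have "(\<lambda>m. d z (s m) + (f (s n) - f (s m))) \<longlonglongrightarrow> 0 + (f (s n) - L)"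
      by (intro tendsto_intros L limitin_qm_topology_imp_tendsto[OF lim sX])
    moreover have "d z (s n) \<le> d z (s m) + (f (s n) - f (s m))" if "n \<le> m" for m
      using triangle[OF zX sX[of m] sX[of n]] d_le[OF that] by linarith
    ultimately have "d z (s n) \<le> 0 + (f (s n) - L)" by (intro LIMSEQ_le_const) auto
    then show ?thesis using fz closed[OF inc lim] S_iff[OF sD zD] by auto
  qed
  have "y = z" if y: "y \<in> ?S z" for y
  proof -
    have yD: "y \<in> ?D" using SD[OF zD y] .
    have "(\<lambda>n. f y + inverse (Suc n)) \<longlonglongrightarrow> f y + 0"
      by (intro tendsto_intros LIMSEQ_inverse_real_of_nat)
    moreover have "f (s (Suc n)) \<le> f y + inverse (Suc n)" for n
      using s_min S_set_trans[OF sX zS y] by blast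
    ultimately have "L \<le> f y"
      using LIMSEQ_le[OF LIMSEQ_Suc[OF L]] by auto
    with y fz have "d y z \<le> 0" using S_iff[OF zD yD] by linarith
    then have "d y z = 0" using nonneg[OF DX[OF yD] zX] by linarith
    then show ?thesis using t1_space_zero_imp_eq[OF t1] DX[OF yD] zX by blast
  qed
  then have "?S z = {z}" using self_mem_S_set[OF zX] by blast
  then show ?thesis using zS[of 0] s0 by auto
qed

end

theorem theorem3p10:
  fixes X :: "'a set" and d :: "'a \<Rightarrow> 'a \<Rightarrow> real" and le :: "'a \<Rightarrow> 'a \<Rightarrow> bool"
    and \<phi> :: "'a \<Rightarrow> ereal"
  assumes space: "preordered_quasi_metric_space X d le"
    and t1: "t1_space (qm_topology X d)"
    and complete: "incr_right_K_complete X d le"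
    and closed: "\<forall>s x. increasing_seq X le s \<and> limitin (qm_topology X d) s x sequentially
                   \<longrightarrow> (\<forall>n. le (s n) x)"
    and phi_codomain: "\<forall>x\<in>X. \<phi> x \<noteq> -\<infinity>"
    and proper: "proper_fun X \<phi>"
    and bdd: "bounded_below_fun X \<phi>"
    and lsc: "increasingly_lsc X d le \<phi>"
  shows
    "(\<exists>z\<in>eff_dom X \<phi>. \<forall>x\<in>eff_dom X \<phi> - {z}. le z x \<longrightarrow> \<phi> z < \<phi> x + ereal (d x z))
   \<and> ((\<forall>x\<in>eff_dom X \<phi>. \<phi> x > Inf (\<phi> ` X) \<longrightarrow> S_set X d le \<phi> x - {x} \<noteq> {})
        \<longrightarrow> (\<exists>z\<in>eff_dom X \<phi>. \<phi> z = Inf (\<phi> ` X)))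
   \<and> (\<forall>T :: 'a \<Rightarrow> 'a.
        (\<forall>x\<in>X. T x \<in> X)
        \<and> (\<forall>x\<in>eff_dom X \<phi>. le x (T x) \<and> ereal (d (T x) x) + \<phi> (T x) \<le> \<phi> x)
        \<longrightarrow> (\<exists>z\<in>eff_dom X \<phi>. T z = z))
   \<and> (\<forall>T :: 'a \<Rightarrow> 'a set.
        (\<forall>x\<in>X. T x \<subseteq> X)
        \<and> (\<forall>x\<in>eff_dom X \<phi>. S_set X d le \<phi> x \<inter> T x \<noteq> {})
        \<longrightarrow> (\<exists>z\<in>eff_dom X \<phi>. z \<in> T z))"
proof -
  interpret preordered_quasi_metric_space X d le by (rule space)
  obtain x0 where x0: "x0 \<in> eff_dom X \<phi>" using proper by (auto simp: proper_fun_def)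
  obtain z where "z \<in> S_set X d le \<phi> x0" and Sz: "S_set X d le \<phi> z = {z}"
    using ex_S_set_singleton[OF t1 complete _ bdd lsc x0] closed by blast
  then have z: "z \<in> eff_dom X \<phi>" using S_set_subset_eff_dom[OF x0] by blast
  then have zX: "z \<in> X" by (simp add: eff_dom_def)
  have "\<phi> z < \<phi> x + ereal (d x z)" if "x \<in> eff_dom X \<phi> - {z}" "le z x" for x
  proof (rule ccontr)
    assume "\<not> ?thesis"
    then have "x \<in> S_set X d le \<phi> z" using that by (auto simp: S_set_def eff_dom_def)
    with Sz that(1) show False by blast
  qed
  moreover have "\<phi> z = Inf (\<phi> ` X)"
    if "\<forall>x\<in>eff_dom X \<phi>. \<phi> x > Inf (\<phi> ` X) \<longrightarrow> S_set X d le \<phi> x - {x} \<noteq> {}"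
    using that z Sz INF_lower[OF zX, of \<phi>] by (auto simp: order.order_iff_strict)
  moreover have "T z = z"
    if "\<forall>x\<in>X. T x \<in> X"
      and "\<forall>x\<in>eff_dom X \<phi>. le x (T x) \<and> ereal (d (T x) x) + \<phi> (T x) \<le> \<phi> x" for T
  proof -
    have "T z \<in> S_set X d le \<phi> z" using that z zX by (auto simp: S_set_def add.commute)
    with Sz show ?thesis by blast
  qed
  moreover have "z \<in> T z" if "\<forall>x\<in>eff_dom X \<phi>. S_set X d le \<phi> x \<inter> T x \<noteq> {}" for T
    using that z Sz by auto
  ultimately show ?thesis using z by blast
qed

end
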